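(* If $p,q\in\mathcal{O}$ with $q\ne0$ and $p/q$ is not a convergent of $z$, then $$|q_n(q_nz-p_n)|<\frac{4\varepsilon\mu^2|q(qz-p)|}{(1-\varepsilon^2)^2}$$ for every $n\geq1$. That is, each $p_n/q_n$ is a best approximation of the second kind up to constants: if $rs\geq(1-\varepsilon^2)^2/4\mu^2$, then $0<|q|<r|q_n|$ implies $|qz-p|>s|q_nz-p_n|$ for any $p\in\mathcal{O}$, except perhaps when $p/q$ is already a convergent.
   Context: Let $\mathcal{O}=\mathbb{Z}[\tau]$ be the ring of discriminant $\Delta$ in an imaginary quadratic field $K$. An ideal is reduced if it is integral and has minimal norm among integral ideals in its class; $D(z,r)$ is the closed disc of radius $r$ centered at $z$. A nonempty finite $B\subset\mathcal{O}\setminus\{0\}$ is admissible with $\varepsilon\in(0,1)$ if for every reduced ideal $\mathfrak{b}$ with $\mathfrak{b}\cap B\neq\emptyset$, $\mathbb{C}=\bigcup D(a/b,\varepsilon/|b|)$ over $a\in\mathfrak{b}^{-1}$, $b\in\mathfrak{b}\cap B$ with $(a\mathfrak{b},b/\mathfrak{b})$ reduced. Fix such $B,\varepsilon$ and let $\mu=\max_{b\in B}|b|$. Let $S(a,b)=\begin{bmatrix}a&1\\ b&0\end{bmatrix}$, $(M)_1$ the ideal generated by the first-column entries of $M$; matrices act as Möbius transformations. Given $z\in\mathbb{C}$, the continued fraction algorithm sets $M_0=I$, $b_0=1$, and for $n\ge1$ chooses (in any way) $b_n\in B$ and $a_n\in\mathcal{O}\cap D(b_nM_{n-1}^{-1}(z),\varepsilon|b_{n-1}|)$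 with $(M_{n-1}S(a_n/b_{n-1},b_n/b_{n-1}))_1$ reduced, and sets $M_n=M_{n-1}S(a_n/b_{n-1},b_n/b_{n-1})$, stopping if $z$ equals the first-column ratio of $M_n$. Let $p_n,q_n$ be the left-column entries of $M_n$; the $p_n/q_n$ are the convergents of $z$.
   Formalization: The condition rs ≥ (1−ε²)²/4μ² in the second sentence is reversed to rs ≤ (1−ε²)²/4μ²; as printed it is false, since for fixed non-convergent p/q and q_n z ≠ p_n, s may be taken arbitrarily large. The first inequality is unchanged. *)

theory Defs
  imports "HOL-Analysis.Analysis" "HOL-Library.Extended_Nat" "HOL-Algebra.QuotRing"
begin

text \<open>
  The quadratic order of discriminant \<open>\<Delta>\<close> is embedded in the complex numbers. The generator
  satisfies \<open>\<tau>\<^sup>2 - \<Delta> \<tau> + (\<Delta>\<^sup>2 - \<Delta>) / 4 = 0\<close>, whose discriminant is \<open>\<Delta>\<close>.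
\<close>

definition quad_tau :: "int \<Rightarrow> complex" where
  "quad_tau \<Delta> = (of_int \<Delta> + \<i> * of_real (sqrt \<bar>of_int \<Delta>\<bar>)) / 2"

definition quad_order :: "int \<Rightarrow> complex set" where
  "quad_order \<Delta> = {of_int x + of_int y * quad_tau \<Delta> | x y :: int. True}"

definition quad_field :: "int \<Rightarrow> complex set" where
  "quad_field \<Delta> = {of_rat x + of_rat y * quad_tau \<Delta> | x y :: rat. True}"

definition quad_ring :: "int \<Rightarrow> complex ring" where
  "quad_ring \<Delta> = \<lparr>carrier = quad_order \<Delta>, monoid.mult = (*), one = 1, zero = 0, add = (+)\<rparr>"

lemma quad_tau_square:
  assumes "\<Delta> < 0" "\<Delta> mod 4 \<in> {0, 1}"
  shows "quad_tau \<Delta> * quad_tau \<Delta> = of_int \<Delta> * quad_tau \<Delta> - of_int ((\<Delta>\<^sup>2 - \<Delta>) div 4)"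
proof -
  have "\<Delta> = 4 * (\<Delta> div 4) \<or> \<Delta> = 4 * (\<Delta> div 4) + 1"
    using assms(2) unfolding insert_iff empty_iff by presburger
  then obtain d where d: "\<Delta> = 4 * d \<or> \<Delta> = 4 * d + 1" by blast
  have "4 * d * (4 * d) - 4 * d = 4 * (4 * d * d - d)"
    and "(4 * d + 1) * (4 * d + 1) - (4 * d + 1) = 4 * (4 * d * d + d)"
    by (simp_all add: algebra_simps)
  with d have "4 dvd \<Delta>\<^sup>2 - \<Delta>"
    unfolding power2_eq_square by (metis dvd_triv_left)
  then obtain k where k: "\<Delta>\<^sup>2 - \<Delta> = 4 * k" by (elim dvdE)
  define s where "s = complex_of_real (sqrt \<bar>of_int \<Delta>\<bar>)"
  have s: "s * s = - of_int \<Delta>"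
    unfolding s_def using assms(1) by (simp flip: of_real_mult)
  have k': "(of_int \<Delta> :: complex) * of_int \<Delta> - of_int \<Delta> = 4 * of_int k"
    using arg_cong[OF k, of "of_int :: int \<Rightarrow> complex"] by (simp add: power2_eq_square)
  have "4 * (quad_tau \<Delta> * quad_tau \<Delta>) = of_int \<Delta> * of_int \<Delta> + 2 * \<i> * s * of_int \<Delta> - s * s"
    unfolding quad_tau_def s_def[symmetric] by (simp add: field_simps)
  also have "\<dots> = 4 * (of_int \<Delta> * quad_tau \<Delta> - of_int k)"
    unfolding s right_diff_distrib k'[symmetric] unfolding quad_tau_def s_def[symmetric]
    by (simp add: field_simps)
  finally have "quad_tau \<Delta> * quad_tau \<Delta> = of_int \<Delta> * quad_tau \<Delta> - of_int k"
    by (subst (asm) mult_cancel_left) simp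
  then show ?thesis using k by simp
qed

lemma cring_quad_ring:
  assumes "\<Delta> < 0" "\<Delta> mod 4 \<in> {0, 1}"
  shows "cring (quad_ring \<Delta>)"
proof -
  define t where "t = quad_tau \<Delta>"
  define k where "k = (\<Delta>\<^sup>2 - \<Delta>) div 4"
  have t: "t * t = of_int \<Delta> * t - of_int k"
    unfolding t_def k_def by (rule quad_tau_square[OF assms])
  have mem: "of_int x + of_int y * t \<in> quad_order \<Delta>" for x y
    unfolding quad_order_def t_def by blast
  have cases: "\<exists>x y. u = of_int x + of_int y * t" if "u \<in> quad_order \<Delta>" for u
    using that unfolding quad_order_def t_def by blast
  have add: "u + v \<in> quad_order \<Delta>" if uv: "u \<in> quad_order \<Delta>" "v \<in> quad_order \<Delta>" for u v
  proof -
    obtain x y x' y' where "u = of_int x + of_int y * t" "v = of_int x' + of_int y' * t"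
      using uv cases by metis
    then have "u + v = of_int (x + x') + of_int (y + y') * t" by (simp add: algebra_simps)
    then show ?thesis using mem by metis
  qed
  have mult: "u * v \<in> quad_order \<Delta>" if uv: "u \<in> quad_order \<Delta>" "v \<in> quad_order \<Delta>" for u v
  proof -
    obtain x y x' y' where e: "u = of_int x + of_int y * t" "v = of_int x' + of_int y' * t"
      using uv cases by metis
    have "u * v = of_int x * of_int x' + (of_int x * of_int y' + of_int y * of_int x') * t
        + of_int y * of_int y' * (t * t)"
      unfolding e by (simp add: algebra_simps)
    also have "\<dots> = of_int (x * x' - y * y' * k) + of_int (x * y' + y * x' + y * y' * \<Delta>) * t"
      unfolding t by (simp add: algebra_simps)
    finally show ?thesis using mem by metis
  qed
  have neg: "- u \<in> quad_order \<Delta>" if u: "u \<in> quad_order \<Delta>" for u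
  proof -
    obtain x y where "u = of_int x + of_int y * t" using u cases by metis
    then have "- u = of_int (- x) + of_int (- y) * t" by simp
    then show ?thesis using mem by metis
  qed
  have zero: "0 \<in> quad_order \<Delta>" using mem[of 0 0] by simp
  have one: "1 \<in> quad_order \<Delta>" using mem[of 1 0] by simp
  show ?thesis
  proof (rule cringI)
    show "abelian_group (quad_ring \<Delta>)"
    proof (rule abelian_groupI)
      fix u assume "u \<in> carrier (quad_ring \<Delta>)"
      then show "\<exists>y\<in>carrier (quad_ring \<Delta>). y \<oplus>\<^bsub>quad_ring \<Delta>\<^esub> u = \<zero>\<^bsub>quad_ring \<Delta>\<^esub>"
        by (intro bexI[of _ "- u"]) (auto simp: quad_ring_def neg)
    qed (auto simp: quad_ring_def add zero)
    show "comm_monoid (quad_ring \<Delta>)"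
      by (rule comm_monoidI) (auto simp: quad_ring_def mult one)
  qed (auto simp: quad_ring_def algebra_simps)
qed

text \<open>For an integral ideal this is the index in the order.\<close>

definition ideal_norm :: "int \<Rightarrow> complex set \<Rightarrow> nat" where
  "ideal_norm \<Delta> \<aa> = card (carrier (quad_ring \<Delta> Quot \<aa>))"

definition same_class :: "int \<Rightarrow> complex set \<Rightarrow> complex set \<Rightarrow> bool" where
  "same_class \<Delta> \<aa> \<cc> \<longleftrightarrow> (\<exists>l \<in> quad_field \<Delta> - {0}. \<cc> = (*) l ` \<aa>)"

definition reduced_ideal :: "int \<Rightarrow> complex set \<Rightarrow> bool" where
  "reduced_ideal \<Delta> \<aa> \<longleftrightarrow> ideal \<aa> (quad_ring \<Delta>) \<and> \<aa> \<noteq> {0} \<and>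
     (\<forall>\<cc>. ideal \<cc> (quad_ring \<Delta>) \<and> same_class \<Delta> \<aa> \<cc> \<longrightarrow> ideal_norm \<Delta> \<aa> \<le> ideal_norm \<Delta> \<cc>)"

definition inv_ideal :: "int \<Rightarrow> complex set \<Rightarrow> complex set" where
  "inv_ideal \<Delta> \<bb> = {x \<in> quad_field \<Delta>. \<forall>y\<in>\<bb>. x * y \<in> quad_order \<Delta>}"

text \<open>
  The fractional ideal \<open>(a\<bb>, b/\<bb>) = a\<bb> + b\<bb>\<^sup>-\<^sup>1\<close>; both summands are already modules over the order.
\<close>

definition twisted_ideal :: "int \<Rightarrow> complex set \<Rightarrow> complex \<Rightarrow> complex \<Rightarrow> complex set" where
  "twisted_ideal \<Delta> \<bb> a b = {a * x + b * y | x y. x \<in> \<bb> \<and> y \<in> inv_ideal \<Delta> \<bb>}"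

definition admissible :: "int \<Rightarrow> complex set \<Rightarrow> real \<Rightarrow> bool" where
  "admissible \<Delta> B \<epsilon> \<longleftrightarrow>
     finite B \<and> B \<noteq> {} \<and> B \<subseteq> quad_order \<Delta> - {0} \<and> 0 < \<epsilon> \<and> \<epsilon> < 1 \<and>
     (\<forall>\<bb>. reduced_ideal \<Delta> \<bb> \<and> \<bb> \<inter> B \<noteq> {} \<longrightarrow>
        (UNIV :: complex set) =
          \<Union> {cball (a / b) (\<epsilon> / cmod b) | a b.
               a \<in> inv_ideal \<Delta> \<bb> \<and> b \<in> \<bb> \<inter> B \<and> reduced_ideal \<Delta> (twisted_ideal \<Delta> \<bb> a b)})"

definition S_mat :: "complex \<Rightarrow> complex \<Rightarrow> complex ^ 2 ^ 2" where
  "S_mat a b = vector [vector [a, 1], vector [b, 0]]"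

definition moebius_act :: "complex ^ 2 ^ 2 \<Rightarrow> complex \<Rightarrow> complex" where
  "moebius_act M z = (M $ 1 $ 1 * z + M $ 1 $ 2) / (M $ 2 $ 1 * z + M $ 2 $ 2)"

definition col1_ideal :: "int \<Rightarrow> complex ^ 2 ^ 2 \<Rightarrow> complex set" where
  "col1_ideal \<Delta> M = {M $ 1 $ 1 * x + M $ 2 $ 1 * y | x y. x \<in> quad_order \<Delta> \<and> y \<in> quad_order \<Delta>}"

fun cf_mat :: "(nat \<Rightarrow> complex) \<Rightarrow> (nat \<Rightarrow> complex) \<Rightarrow> nat \<Rightarrow> complex ^ 2 ^ 2" where
  "cf_mat a b 0 = mat 1"
| "cf_mat a b (Suc n) = cf_mat a b n ** S_mat (a (Suc n) / b n) (b (Suc n) / b n)"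

definition cf_p :: "(nat \<Rightarrow> complex) \<Rightarrow> (nat \<Rightarrow> complex) \<Rightarrow> nat \<Rightarrow> complex" where
  "cf_p a b n = cf_mat a b n $ 1 $ 1"

definition cf_q :: "(nat \<Rightarrow> complex) \<Rightarrow> (nat \<Rightarrow> complex) \<Rightarrow> nat \<Rightarrow> complex" where
  "cf_q a b n = cf_mat a b n $ 2 $ 1"

text \<open>
  The finite number \<open>w\<close> equals the ratio \<open>p\<^sub>n / q\<^sub>n\<close> in the Riemann sphere. The condition on \<open>q\<^sub>n\<close> is
  needed because \<open>p\<^sub>0 / q\<^sub>0 = 1 / 0\<close> is the point at infinity, not \<open>0\<close>.
\<close>

definition eq_ratio :: "(nat \<Rightarrow> complex) \<Rightarrow> (nat \<Rightarrow> complex) \<Rightarrow> nat \<Rightarrow> complex \<Rightarrow> bool" where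
  "eq_ratio a b n w \<longleftrightarrow> cf_q a b n \<noteq> 0 \<and> w = cf_p a b n / cf_q a b n"

text \<open>
  A complete execution of the algorithm on \<open>z\<close> with some choices \<open>a\<close>, \<open>b\<close>: the matrices produced
  are those with index at most \<open>N\<close>, where \<open>N = \<infinity>\<close> if the stopping condition is never met, and
  otherwise \<open>N\<close> is the index at which it is met. The value \<open>a 0\<close> is never used.
  The inverse of the previous matrix maps \<open>z\<close> to infinity only if the algorithm has already stopped,
  so the division in \<^const>\<open>moebius_act\<close> is never by zero here.
\<close>

definition cf_run ::
  "int \<Rightarrow> complex set \<Rightarrow> real \<Rightarrow> complex \<Rightarrow> (nat \<Rightarrow> complex) \<Rightarrow> (nat \<Rightarrow> complex) \<Rightarrow> enat \<Rightarrow> bool" where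
  "cf_run \<Delta> B \<epsilon> z a b N \<longleftrightarrow>
     b 0 = 1 \<and>
     (\<forall>n\<ge>1. enat n \<le> N \<longrightarrow>
        b n \<in> B \<and>
        a n \<in> quad_order \<Delta> \<inter>
          cball (b n * moebius_act (matrix_inv (cf_mat a b (n - 1))) z) (\<epsilon> * cmod (b (n - 1))) \<and>
        reduced_ideal \<Delta> (col1_ideal \<Delta> (cf_mat a b n))) \<and>
     (\<forall>n. enat n \<le> N \<longrightarrow> (eq_ratio a b n z \<longleftrightarrow> N = enat n))"

definition is_convergent :: "(nat \<Rightarrow> complex) \<Rightarrow> (nat \<Rightarrow> complex) \<Rightarrow> enat \<Rightarrow> complex \<Rightarrow> bool" where
  "is_convergent a b N w \<longleftrightarrow> (\<exists>n. enat n \<le> N \<and> eq_ratio a b n w)"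

end

theory Submission imports Defs begin

text \<open>
  Put \<open>e\<^sub>n = q\<^sub>n z - p\<^sub>n\<close>. The choice of \<open>a\<^sub>n\<close> gives \<open>|e\<^sub>n| \<le> \<epsilon> |e\<^sub>n\<^sub>-\<^sub>1|\<close>, and the determinant
  identity \<open>|q\<^sub>n\<^sub>-\<^sub>1 e\<^sub>n - q\<^sub>n e\<^sub>n\<^sub>-\<^sub>1| = |b\<^sub>n| \<le> \<mu>\<close> then yields \<open>|q\<^sub>n e\<^sub>n\<^sub>-\<^sub>1| < \<mu> / (1 - \<epsilon>\<^sup>2)\<close> by summing
  a geometric series; hence \<open>|q\<^sub>n e\<^sub>n| < \<epsilon> \<mu> / (1 - \<epsilon>\<^sup>2)\<close>.
  If \<open>p/q\<close> is not a convergent and \<open>e = q z - p\<close>, then \<open>q e\<^sub>n - q\<^sub>n e = q\<^sub>n p - q p\<^sub>n\<close> is a nonzero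
  element of the order, so \<open>|q e\<^sub>n| + |q\<^sub>n e| \<ge> 1\<close> for all \<open>n\<close>. At the index \<open>n\<close> where \<open>|q e\<^sub>n|\<close> first
  drops to at most \<open>1/2\<close> both \<open>|q e\<^sub>n\<^sub>-\<^sub>1|\<close> and \<open>|q\<^sub>n e|\<close> are at least \<open>1/2\<close>, and dividing their product
  by \<open>|q\<^sub>n e\<^sub>n\<^sub>-\<^sub>1|\<close> shows \<open>|q e| > (1 - \<epsilon>\<^sup>2) / (4 \<mu>)\<close>.
\<close>

locale contracting_remainders =
  fixes q e :: "nat \<Rightarrow> 'a::real_normed_field" and N :: enat and \<epsilon> \<mu> :: real
  assumes \<epsilon>_pos: "0 < \<epsilon>" and \<epsilon>_less_1: "\<epsilon> < 1" and \<mu>_pos: "0 < \<mu>"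
    and q_0: "q 0 = 0" and norm_e_0: "norm (e 0) = 1"
    and norm_e_Suc_le: "enat n < N \<Longrightarrow> norm (e (Suc n)) \<le> \<epsilon> * norm (e n)"
    and norm_det_le: "enat n < N \<Longrightarrow> norm (q n * e (Suc n) - q (Suc n) * e n) \<le> \<mu>"
    and e_last: "N = enat n \<Longrightarrow> e n = 0"
begin

lemma one_minus_\<epsilon>_square_pos: "0 < 1 - \<epsilon>\<^sup>2"
  using \<epsilon>_pos \<epsilon>_less_1 by (simp add: power_less_one_iff)

lemma norm_q_Suc_mult_e_less: "norm (q (Suc n) * e n) < \<mu> / (1 - \<epsilon>\<^sup>2)" if "enat n < N"
  using that
proof (induction n)
  case 0
  have "norm (q (Suc 0) * e 0) \<le> \<mu>" using norm_det_le[OF 0] q_0 by simp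
  also have "\<dots> < \<mu> / (1 - \<epsilon>\<^sup>2)"
    using \<mu>_pos \<epsilon>_pos one_minus_\<epsilon>_square_pos by (simp add: less_divide_eq)
  finally show ?case .
next
  case (Suc n)
  have n: "enat n < N" using Suc.prems by (metis Suc_ile_eq order_less_imp_le)
  have "norm (e (Suc (Suc n))) \<le> \<epsilon> * norm (e (Suc n))" by (rule norm_e_Suc_le[OF Suc.prems])
  also have "\<dots> \<le> \<epsilon> * (\<epsilon> * norm (e n))"
    using norm_e_Suc_le[OF n] \<epsilon>_pos by simp
  finally have two_steps: "norm (e (Suc (Suc n))) \<le> \<epsilon>\<^sup>2 * norm (e n)"
    by (simp add: power2_eq_square mult_ac)
  have "norm (q (Suc (Suc n)) * e (Suc n)) \<le> norm (q (Suc n) * e (Suc (Suc n))) + \<mu>"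
    using norm_det_le[OF Suc.prems]
      norm_triangle_sub[of "q (Suc (Suc n)) * e (Suc n)" "q (Suc n) * e (Suc (Suc n))"]
    by (simp add: norm_minus_commute)
  also have "\<dots> \<le> \<epsilon>\<^sup>2 * norm (q (Suc n) * e n) + \<mu>"
    using mult_left_mono[OF two_steps, of "norm (q (Suc n))"] by (simp add: norm_mult mult_ac)
  also have "\<dots> < \<epsilon>\<^sup>2 * (\<mu> / (1 - \<epsilon>\<^sup>2)) + \<mu>"
    using mult_strict_left_mono[OF Suc.IH[OF n], of "\<epsilon>\<^sup>2"] \<epsilon>_pos by simp
  also have "\<dots> = \<mu> / (1 - \<epsilon>\<^sup>2)" using one_minus_\<epsilon>_square_pos by (simp add: field_simps)
  finally show ?case .
qed

lemma norm_q_mult_e_less: "norm (q n * e n) < \<epsilon> * \<mu> / (1 - \<epsilon>\<^sup>2)" if "enat n \<le> N"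
proof (cases n)
  case 0
  then show ?thesis using q_0 \<epsilon>_pos \<mu>_pos one_minus_\<epsilon>_square_pos by simp
next
  case (Suc m)
  then have m: "enat m < N" using that by (simp add: Suc_ile_eq)
  have "norm (q n * e n) \<le> \<epsilon> * norm (q (Suc m) * e m)"
    using mult_left_mono[OF norm_e_Suc_le[OF m], of "norm (q n)"]
    by (simp add: Suc norm_mult mult_ac)
  also have "\<dots> < \<epsilon> * (\<mu> / (1 - \<epsilon>\<^sup>2))"
    using norm_q_Suc_mult_e_less[OF m] \<epsilon>_pos by (rule mult_strict_left_mono)
  finally show ?thesis by simp
qed

lemma norm_e_le_power: "norm (e n) \<le> \<epsilon> ^ n" if "enat n \<le> N"
  using that
proof (induction n)
  case 0
  then show ?case by (simp add: norm_e_0)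
next
  case (Suc n)
  then have n: "enat n < N" by (simp add: Suc_ile_eq)
  have "norm (e (Suc n)) \<le> \<epsilon> * norm (e n)" by (rule norm_e_Suc_le[OF n])
  also have "\<dots> \<le> \<epsilon> * \<epsilon> ^ n" using Suc.IH n \<epsilon>_pos by simp
  finally show ?case by simp
qed

lemma arbitrarily_small_e:
  assumes "0 < \<delta>"
  obtains n where "enat n \<le> N" "norm (e n) < \<delta>"
proof (cases N)
  case (enat n)
  then show ?thesis using that[of n] e_last[of n] assms by simp
next
  case infinity
  obtain n where "\<epsilon> ^ n < \<delta>" using real_arch_pow_inv[OF assms \<epsilon>_less_1] by blast
  then show ?thesis using that[of n] norm_e_le_power[of n] infinity by simp
qed

definition separated :: "'a \<Rightarrow> 'a \<Rightarrow> bool" where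
  "separated x y \<longleftrightarrow> (\<forall>n. enat n \<le> N \<longrightarrow> 1 \<le> norm (x * e n) + norm (q n * y))"

lemma separatedD: "1 \<le> norm (x * e n) + norm (q n * y)" if "separated x y" "enat n \<le> N"
  using that by (simp add: separated_def)

lemma separated_imp_one_le_norm: "1 \<le> norm x" if "separated x y"
  using separatedD[OF that, of 0] by (simp add: zero_enat_def[symmetric] q_0 norm_mult norm_e_0)

lemma separated_crossing_index:
  assumes "separated x y"
  obtains m where "enat m < N" "1 / 2 < norm (x * e m)" "1 / 2 \<le> norm (q (Suc m) * y)"
proof -
  define small where "small n \<longleftrightarrow> enat n \<le> N \<and> norm (x * e n) \<le> 1 / 2" for n
  have one_le_x: "1 \<le> norm x" by (rule separated_imp_one_le_norm[OF assms])
  then have x_pos: "0 < norm x" by linarith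
  then have "0 < 1 / 2 / norm x" by (intro divide_pos_pos) simp_all
  then obtain k where k: "enat k \<le> N" "norm (e k) < 1 / 2 / norm x"
    by (rule arbitrarily_small_e)
  from k(2) have "norm (e k) * norm x < 1 / 2" by (simp only: pos_less_divide_eq[OF x_pos])
  with k(1) have "small k" by (simp add: small_def norm_mult mult.commute)
  moreover have "\<not> small 0" using one_le_x by (simp add: small_def norm_mult norm_e_0)
  ultimately obtain m where m: "\<not> small m" "small (Suc m)"
    using ex_least_nat_less[of small k] by blast
  have m_less: "enat m < N" using m(2) by (simp add: small_def Suc_ile_eq)
  moreover have "1 / 2 < norm (x * e m)"
    using m(1) less_imp_le[OF m_less] by (simp add: small_def not_le)
  moreover have "1 / 2 \<le> norm (q (Suc m) * y)"
    using separatedD[OF assms, of "Suc m"] m(2) by (simp add: small_def)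
  ultimately show ?thesis by (rule that)
qed

lemma separated_norm_mult_greater:
  assumes "separated x y"
  shows "(1 - \<epsilon>\<^sup>2) / (4 * \<mu>) < norm (x * y)"
proof -
  obtain m where m: "enat m < N" "1 / 2 < norm (x * e m)" "1 / 2 \<le> norm (q (Suc m) * y)"
    using separated_crossing_index[OF assms] .
  have "1 / 2 * (1 / 2) \<le> norm (x * e m) * norm (q (Suc m) * y)"
    using m(2,3) by (intro mult_mono) auto
  also have "\<dots> = norm (q (Suc m) * e m) * norm (x * y)" by (simp add: norm_mult)
  finally have quarter_le: "1 / 4 \<le> norm (q (Suc m) * e m) * norm (x * y)" by simp
  then have "0 < norm (x * y)" by (cases "x * y = 0") auto
  with norm_q_Suc_mult_e_less[OF m(1)]
  have "norm (q (Suc m) * e m) * norm (x * y) < \<mu> / (1 - \<epsilon>\<^sup>2) * norm (x * y)"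
    by (rule mult_strict_right_mono)
  with quarter_le have "1 / 4 < \<mu> / (1 - \<epsilon>\<^sup>2) * norm (x * y)" by linarith
  then show ?thesis using one_minus_\<epsilon>_square_pos \<mu>_pos by (simp add: field_simps)
qed

lemma norm_q_mult_e_less_separated:
  assumes "separated x y" "enat n \<le> N"
  shows "norm (q n * e n) < 4 * \<epsilon> * \<mu>\<^sup>2 * norm (x * y) / (1 - \<epsilon>\<^sup>2)\<^sup>2"
proof -
  define d where "d = 1 - \<epsilon>\<^sup>2"
  have d_pos: "0 < d" unfolding d_def by (rule one_minus_\<epsilon>_square_pos)
  have "norm (q n * e n) < \<epsilon> * \<mu> / d"
    unfolding d_def by (rule norm_q_mult_e_less[OF assms(2)])
  also have "\<dots> = 4 * \<epsilon> * \<mu>\<^sup>2 / d\<^sup>2 * (d / (4 * \<mu>))"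
    using d_pos \<mu>_pos by (simp add: field_simps power2_eq_square)
  also have "\<dots> < 4 * \<epsilon> * \<mu>\<^sup>2 / d\<^sup>2 * norm (x * y)"
    using separated_norm_mult_greater[OF assms(1)] d_pos \<mu>_pos \<epsilon>_pos
    by (intro mult_strict_left_mono) (auto simp: d_def)
  finally show ?thesis by (simp add: d_def)
qed

lemma mult_norm_e_less_separated:
  assumes sep: "separated x y" and n: "enat n \<le> N"
    and rs: "r * s \<le> (1 - \<epsilon>\<^sup>2)\<^sup>2 / (4 * \<mu>\<^sup>2)"
    and less: "norm x < r * norm (q n)"
  shows "s * norm (e n) < norm y"
proof -
  have "r * s * norm (q n * e n) \<le> (1 - \<epsilon>\<^sup>2)\<^sup>2 / (4 * \<mu>\<^sup>2) * norm (q n * e n)"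
    by (rule mult_right_mono[OF rs norm_ge_zero])
  also have "\<dots> < \<epsilon> * norm (x * y)"
    using norm_q_mult_e_less_separated[OF sep n] \<mu>_pos one_minus_\<epsilon>_square_pos
    by (simp add: field_simps)
  also have "\<dots> \<le> norm x * norm y"
    using \<epsilon>_less_1 by (simp add: norm_mult mult_left_le_one_le \<epsilon>_pos less_imp_le)
  also have "\<dots> \<le> r * norm (q n) * norm y"
    using less by (intro mult_right_mono) auto
  finally have "r * norm (q n) * (s * norm (e n)) < r * norm (q n) * norm y"
    by (simp add: norm_mult mult_ac)
  moreover have "0 < r * norm (q n)" using norm_ge_zero less by (rule le_less_trans)
  ultimately show ?thesis by (simp only: mult_less_cancel_left_pos)
qed

end

lemma zero_in_quad_order: "0 \<in> quad_order \<Delta>"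
  unfolding quad_order_def by (intro CollectI exI[of _ 0]) simp

lemma one_in_quad_order: "1 \<in> quad_order \<Delta>"
  unfolding quad_order_def by (intro CollectI exI[of _ 1] exI[of _ 0]) simp

lemma diff_in_quad_order:
  assumes "u \<in> quad_order \<Delta>" "v \<in> quad_order \<Delta>"
  shows "u - v \<in> quad_order \<Delta>"
proof -
  obtain x y x' y' where "u = of_int x + of_int y * quad_tau \<Delta>"
    and "v = of_int x' + of_int y' * quad_tau \<Delta>"
    using assms unfolding quad_order_def by blast
  then have "u - v = of_int (x - x') + of_int (y - y') * quad_tau \<Delta>"
    by (simp add: algebra_simps)
  then show ?thesis unfolding quad_order_def by blast
qed

lemma col1_entries_in_col1_ideal:
  "M $ 1 $ 1 \<in> col1_ideal \<Delta> M" "M $ 2 $ 1 \<in> col1_ideal \<Delta> M"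
proof -
  have "M $ 1 $ 1 * 1 + M $ 2 $ 1 * 0 \<in> col1_ideal \<Delta> M"
    "M $ 1 $ 1 * 0 + M $ 2 $ 1 * 1 \<in> col1_ideal \<Delta> M"
    unfolding col1_ideal_def using zero_in_quad_order one_in_quad_order by blast+
  then show "M $ 1 $ 1 \<in> col1_ideal \<Delta> M" "M $ 2 $ 1 \<in> col1_ideal \<Delta> M" by simp_all
qed

lemma reduced_ideal_subset_quad_order: "\<aa> \<subseteq> quad_order \<Delta>" if "reduced_ideal \<Delta> \<aa>"
  using that ideal.Icarr unfolding reduced_ideal_def by (fastforce simp: quad_ring_def)

locale imaginary_quadratic_order =
  fixes \<Delta> :: int
  assumes \<Delta>_neg: "\<Delta> < 0" and \<Delta>_mod_4: "\<Delta> mod 4 \<in> {0, 1}"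
begin

lemma mult_in_quad_order:
  assumes "u \<in> quad_order \<Delta>" "v \<in> quad_order \<Delta>"
  shows "u * v \<in> quad_order \<Delta>"
proof -
  interpret cring "quad_ring \<Delta>" by (rule cring_quad_ring[OF \<Delta>_neg \<Delta>_mod_4])
  show ?thesis using m_closed[of u v] assms by (simp add: quad_ring_def)
qed

lemma cmod_square_quad_order_element:
  "(cmod (of_int x + of_int y * quad_tau \<Delta>))\<^sup>2
     = of_int (x\<^sup>2 + \<Delta> * x * y + (\<Delta>\<^sup>2 - \<Delta>) div 4 * y\<^sup>2)"
proof -
  define t where "t = quad_tau \<Delta>"
  define k where "k = (\<Delta>\<^sup>2 - \<Delta>) div 4"
  have cnj_t: "cnj t = of_int \<Delta> - t"
    by (simp add: t_def quad_tau_def complex_eq_iff)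
  have norm_t: "t * (of_int \<Delta> - t) = of_int k"
    using quad_tau_square[OF \<Delta>_neg \<Delta>_mod_4] by (simp add: t_def k_def algebra_simps)
  have "of_real ((cmod (of_int x + of_int y * t))\<^sup>2)
      = (of_int x + of_int y * t) * (of_int x + of_int y * (of_int \<Delta> - t))"
    unfolding complex_norm_square by (simp add: cnj_t)
  also have "\<dots> = (of_int x)\<^sup>2 + of_int \<Delta> * of_int x * of_int y
      + t * (of_int \<Delta> - t) * (of_int y)\<^sup>2"
    by (simp add: algebra_simps power2_eq_square)
  also have "\<dots> = of_real (of_int (x\<^sup>2 + \<Delta> * x * y + k * y\<^sup>2))"
    unfolding norm_t by simp
  finally show ?thesis unfolding t_def k_def by (simp only: of_real_eq_iff)
qed

lemma one_le_cmod_quad_order: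
  assumes "u \<in> quad_order \<Delta>" "u \<noteq> 0"
  shows "1 \<le> cmod u"
proof -
  obtain m :: int where m: "(cmod u)\<^sup>2 = of_int m"
    using assms(1) cmod_square_quad_order_element unfolding quad_order_def by blast
  have "0 < (cmod u)\<^sup>2" using assms(2) by simp
  then have "1\<^sup>2 \<le> (cmod u)\<^sup>2" unfolding m by simp
  then show ?thesis by (rule power2_le_imp_le) simp
qed

end

lemma matrix_mul_matrix_inv: "A ** matrix_inv A = mat 1" if "invertible A"
  using someI_ex[OF that[unfolded invertible_def]] by (simp add: matrix_inv_def)

definition remainder_row :: "complex \<Rightarrow> complex ^ 2 ^ 2 \<Rightarrow> complex ^ 2" where
  "remainder_row z M = vector [-1, z] v* M"

lemma remainder_row_nth: "remainder_row z M $ j = M $ 2 $ j * z - M $ 1 $ j"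
  by (simp add: remainder_row_def vector_matrix_mult_def sum_2)

lemma remainder_row_mult: "remainder_row z (M ** A) = remainder_row z M v* A"
  by (simp add: remainder_row_def vector_matrix_mul_assoc)

lemma moebius_act_matrix_inv:
  assumes "invertible M" and "remainder_row z M $ 1 \<noteq> 0"
  shows "moebius_act (matrix_inv M) z = - (remainder_row z M $ 2 / remainder_row z M $ 1)"
proof -
  define u where "u = matrix_inv M *v vector [z, 1]"
  define r where "r = remainder_row z M"
  have M_u: "M *v u = vector [z, 1]"
    by (simp add: u_def matrix_vector_mul_assoc matrix_mul_matrix_inv assms(1))
  have "r $ 1 * u $ 1 + r $ 2 * u $ 2 = (M *v u) $ 2 * z - (M *v u) $ 1"
    by (simp add: r_def remainder_row_nth matrix_vector_mult_def sum_2 algebra_simps)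
  also have "\<dots> = 0" by (simp add: M_u)
  finally have orthogonal: "r $ 1 * u $ 1 + r $ 2 * u $ 2 = 0" .
  have "u \<noteq> 0"
  proof
    assume "u = 0"
    with M_u have "(vector [z, 1] :: complex ^ 2) $ 2 = 0" by simp
    then show False by simp
  qed
  with orthogonal have "u $ 2 \<noteq> 0"
    using assms(2) by (auto simp: r_def vec_eq_iff forall_2)
  with orthogonal have "u $ 1 / u $ 2 = - (r $ 2 / r $ 1)"
    using assms(2) by (simp add: r_def field_simps add_eq_0_iff)
  then show ?thesis
    by (simp add: u_def r_def moebius_act_def matrix_vector_mult_def sum_2)
qed

lemma remainder_row_mult_S_mat:
  assumes "invertible M" and "remainder_row z M $ 1 \<noteq> 0"
  shows "remainder_row z (M ** S_mat x y) $ 1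
    = (x - y * moebius_act (matrix_inv M) z) * remainder_row z M $ 1"
proof -
  have "remainder_row z (M ** S_mat x y) $ 1
      = remainder_row z M $ 1 * x + remainder_row z M $ 2 * y"
    by (simp add: remainder_row_mult vector_matrix_mult_def sum_2 S_mat_def)
  then show ?thesis
    using assms by (simp add: moebius_act_matrix_inv field_simps)
qed

lemma cf_p_0: "cf_p a b 0 = 1" and cf_q_0: "cf_q a b 0 = 0"
  by (simp_all add: cf_p_def cf_q_def mat_def)

lemma cf_mat_Suc_col2: "cf_mat a b (Suc n) $ i $ 2 = cf_mat a b n $ i $ 1"
  by (simp add: matrix_matrix_mult_def sum_2 S_mat_def)

lemma det_cf_mat:
  assumes "b 0 = 1" and "\<And>k. k < n \<Longrightarrow> b k \<noteq> 0"
  shows "det (cf_mat a b n) = (-1) ^ n * b n"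
  using assms(2)
proof (induction n)
  case 0
  then show ?case using assms(1) by simp
next
  case (Suc n)
  then have "det (cf_mat a b n) = (-1) ^ n * b n" "b n \<noteq> 0" by simp_all
  moreover have "det (S_mat (a (Suc n) / b n) (b (Suc n) / b n)) = - (b (Suc n) / b n)"
    by (simp add: S_mat_def det_2)
  ultimately show ?case by (simp add: det_mul)
qed

locale cf_execution = imaginary_quadratic_order \<Delta> for \<Delta> :: int +
  fixes B :: "complex set" and \<epsilon> \<mu> :: real and z :: complex
    and a b :: "nat \<Rightarrow> complex" and N :: enat
  assumes admissible: "admissible \<Delta> B \<epsilon>"
    and cmod_le_\<mu>: "c \<in> B \<Longrightarrow> cmod c \<le> \<mu>"
    and cf_run: "cf_run \<Delta> B \<epsilon> z a b N"
begin

abbreviation "P \<equiv> cf_p a b"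
abbreviation "Q \<equiv> cf_q a b"
abbreviation "E n \<equiv> Q n * z - P n"

lemma E_eq_remainder_row: "E n = remainder_row z (cf_mat a b n) $ 1"
  by (simp add: remainder_row_nth cf_p_def cf_q_def)

lemma b_0: "b 0 = 1"
  using cf_run by (simp add: cf_run_def)

lemma b_Suc_in_B: "b (Suc n) \<in> B" if "enat n < N"
  using cf_run that by (simp add: cf_run_def Suc_ile_eq)

lemma a_Suc_close:
  assumes "enat n < N"
  shows "cmod (a (Suc n) - b (Suc n) * moebius_act (matrix_inv (cf_mat a b n)) z)
    \<le> \<epsilon> * cmod (b n)"
proof -
  have "a (Suc n) \<in> quad_order \<Delta> \<inter>
      cball (b (Suc n) * moebius_act (matrix_inv (cf_mat a b (Suc n - 1))) z)
        (\<epsilon> * cmod (b (Suc n - 1)))"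
    using cf_run assms le_add1[of 1 n] unfolding cf_run_def Suc_ile_eq[symmetric] plus_1_eq_Suc
    by blast
  then show ?thesis by (simp add: dist_norm norm_minus_commute)
qed

lemma b_nonzero: "b n \<noteq> 0" if "enat n \<le> N"
proof (cases n)
  case 0
  then show ?thesis by (simp add: b_0)
next
  case (Suc m)
  then have "b n \<in> B" using b_Suc_in_B that by (simp add: Suc_ile_eq)
  then show ?thesis using admissible unfolding admissible_def by blast
qed

lemma det_cf_mat_eq: "det (cf_mat a b n) = (-1) ^ n * b n" if "enat n \<le> N"
proof (intro det_cf_mat b_0)
  fix k assume "k < n"
  then have "enat k \<le> N" using that by (meson enat_ord_simps(1) less_imp_le order_trans)
  then show "b k \<noteq> 0" by (rule b_nonzero)
qed

lemma invertible_cf_mat: "invertible (cf_mat a b n)" if "enat n \<le> N"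
  using that by (simp add: invertible_det_nz det_cf_mat_eq b_nonzero)

lemma P_nonzero_or_Q_nonzero: "P n \<noteq> 0 \<or> Q n \<noteq> 0" if "enat n \<le> N"
  using invertible_cf_mat[OF that] by (auto simp: invertible_det_nz det_2 cf_p_def cf_q_def)

lemma eq_ratio_iff: "eq_ratio a b n (x / y) \<longleftrightarrow> Q n * x = y * P n" if "enat n \<le> N" "y \<noteq> 0"
  using P_nonzero_or_Q_nonzero[OF that(1)] that(2)
  by (cases "Q n = 0") (auto simp: eq_ratio_def field_simps)

lemma E_eq_0_iff: "E n = 0 \<longleftrightarrow> N = enat n" if "enat n \<le> N"
proof -
  have "E n = 0 \<longleftrightarrow> eq_ratio a b n z"
    using eq_ratio_iff[OF that, of 1 z] by simp
  then show ?thesis using cf_run that unfolding cf_run_def by blast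
qed

lemma cmod_E_Suc_le: "cmod (E (Suc n)) \<le> \<epsilon> * cmod (E n)" if "enat n < N"
proof -
  define w where "w = moebius_act (matrix_inv (cf_mat a b n)) z"
  have n: "enat n \<le> N" using that by simp
  have b_n_nonzero: "b n \<noteq> 0" by (rule b_nonzero[OF n])
  have E_n_nonzero: "E n \<noteq> 0" using E_eq_0_iff[OF n] that by auto
  have "E (Suc n) = (a (Suc n) / b n - b (Suc n) / b n * w) * E n"
    using remainder_row_mult_S_mat[OF invertible_cf_mat[OF n], of z] E_n_nonzero
    unfolding E_eq_remainder_row w_def by simp
  also have "\<dots> = (a (Suc n) - b (Suc n) * w) / b n * E n"
    by (simp add: diff_divide_distrib)
  finally have "cmod (E (Suc n)) = cmod (a (Suc n) - b (Suc n) * w) / cmod (b n) * cmod (E n)"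
    by (simp only: norm_mult norm_divide)
  also have "\<dots> \<le> \<epsilon> * cmod (E n)"
    using a_Suc_close[OF that] b_n_nonzero
    by (intro mult_right_mono) (simp_all add: w_def pos_divide_le_eq)
  finally show ?thesis .
qed

lemma cmod_Q_E_det:
  assumes "enat n < N"
  shows "cmod (Q n * E (Suc n) - Q (Suc n) * E n) = cmod (b (Suc n))"
proof -
  have "Q n * E (Suc n) - Q (Suc n) * E n = - det (cf_mat a b (Suc n))"
    unfolding det_2 cf_mat_Suc_col2 cf_p_def cf_q_def by (simp add: algebra_simps)
  then show ?thesis
    using assms by (simp add: det_cf_mat_eq Suc_ile_eq norm_mult norm_power del: cf_mat.simps)
qed

sublocale contracting_remainders Q E N \<epsilon> \<mu>
proof
  show "0 < \<epsilon>" "\<epsilon> < 1" using admissible by (simp_all add: admissible_def)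
  obtain c where "c \<in> B" "c \<noteq> 0" using admissible unfolding admissible_def by blast
  then show "0 < \<mu>" using cmod_le_\<mu> by (meson less_le_trans zero_less_norm_iff)
  show "cmod (E (Suc n)) \<le> \<epsilon> * cmod (E n)" if "enat n < N" for n
    using that by (rule cmod_E_Suc_le)
  show "cmod (Q n * E (Suc n) - Q (Suc n) * E n) \<le> \<mu>" if "enat n < N" for n
    using that by (simp only: cmod_Q_E_det cmod_le_\<mu> b_Suc_in_B)
  show "E n = 0" if "N = enat n" for n
    using that E_eq_0_iff by simp
qed (simp_all add: cf_p_0 cf_q_0)

lemma P_Q_in_quad_order: "P n \<in> quad_order \<Delta> \<and> Q n \<in> quad_order \<Delta>" if "enat n \<le> N"
proof (cases "n = 0")
  case True
  then show ?thesis by (simp add: cf_p_0 cf_q_0 zero_in_quad_order one_in_quad_order)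
next
  case False
  then have "reduced_ideal \<Delta> (col1_ideal \<Delta> (cf_mat a b n))"
    using cf_run that by (simp add: cf_run_def)
  then show ?thesis
    unfolding cf_p_def cf_q_def
    using reduced_ideal_subset_quad_order col1_entries_in_col1_ideal by blast
qed

lemma separated_if_not_convergent:
  assumes p: "p \<in> quad_order \<Delta>" and q: "q \<in> quad_order \<Delta>" "q \<noteq> 0"
    and not_convergent: "\<not> is_convergent a b N (p / q)"
  shows "separated q (q * z - p)"
  unfolding separated_def
proof (intro allI impI)
  fix n assume n: "enat n \<le> N"
  have "\<not> eq_ratio a b n (p / q)"
    using not_convergent n unfolding is_convergent_def by blast
  then have "Q n * p - q * P n \<noteq> 0" using eq_ratio_iff[OF n q(2)] by simp
  then have "1 \<le> cmod (Q n * p - q * P n)"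
    using p q(1) P_Q_in_quad_order[OF n]
    by (intro one_le_cmod_quad_order diff_in_quad_order mult_in_quad_order) auto
  also have "Q n * p - q * P n = q * E n - Q n * (q * z - p)" by (simp add: algebra_simps)
  also have "cmod \<dots> \<le> cmod (q * E n) + cmod (Q n * (q * z - p))"
    by (rule norm_triangle_ineq4)
  finally show "1 \<le> cmod (q * E n) + cmod (Q n * (q * z - p))" .
qed

end

theorem theorem4p8:
  fixes \<Delta> :: int and B :: "complex set" and \<epsilon> \<mu> :: real and z :: complex
    and a b :: "nat \<Rightarrow> complex" and N :: enat and n :: nat
  assumes "\<Delta> < 0" and "\<Delta> mod 4 \<in> {0, 1}"
    and "admissible \<Delta> B \<epsilon>"
    and "\<mu> = Max (cmod ` B)"
    and "cf_run \<Delta> B \<epsilon> z a b N"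
    and "1 \<le> n" and "enat n \<le> N"
  shows "(\<forall>p \<in> quad_order \<Delta>. \<forall>q \<in> quad_order \<Delta>.
            q \<noteq> 0 \<and> \<not> is_convergent a b N (p / q) \<longrightarrow>
              cmod (cf_q a b n * (cf_q a b n * z - cf_p a b n))
                < 4 * \<epsilon> * \<mu>\<^sup>2 * cmod (q * (q * z - p)) / (1 - \<epsilon>\<^sup>2)\<^sup>2) \<and>
         (\<forall>r s :: real. r * s \<le> (1 - \<epsilon>\<^sup>2)\<^sup>2 / (4 * \<mu>\<^sup>2) \<longrightarrow>
            (\<forall>p \<in> quad_order \<Delta>. \<forall>q \<in> quad_order \<Delta>.
               0 < cmod q \<and> cmod q < r * cmod (cf_q a b n) \<and> \<not> is_convergent a b N (p / q) \<longrightarrow>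
                 cmod (q * z - p) > s * cmod (cf_q a b n * z - cf_p a b n)))"
proof -
  interpret cf_execution \<Delta> B \<epsilon> \<mu> z a b N
    using assms(1-5) by unfold_locales (auto simp: admissible_def)
  show ?thesis
  proof (intro conjI allI ballI impI; elim conjE)
    fix p q
    assume "p \<in> quad_order \<Delta>" "q \<in> quad_order \<Delta>" "q \<noteq> 0" "\<not> is_convergent a b N (p / q)"
    then have "separated q (q * z - p)" by (rule separated_if_not_convergent)
    then show "cmod (Q n * E n) < 4 * \<epsilon> * \<mu>\<^sup>2 * cmod (q * (q * z - p)) / (1 - \<epsilon>\<^sup>2)\<^sup>2"
      using assms(7) by (rule norm_q_mult_e_less_separated)
  next
    fix r s :: real and p q
    assume rs: "r * s \<le> (1 - \<epsilon>\<^sup>2)\<^sup>2 / (4 * \<mu>\<^sup>2)"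
      and pq: "p \<in> quad_order \<Delta>" "q \<in> quad_order \<Delta>" "0 < cmod q" "\<not> is_convergent a b N (p / q)"
      and less: "cmod q < r * cmod (Q n)"
    have "separated q (q * z - p)" using pq by (intro separated_if_not_convergent) auto
    from this assms(7) rs less show "s * cmod (E n) < cmod (q * z - p)"
      by (rule mult_norm_e_less_separated)
  qed
qed

end
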